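(* Let $n\ge5$ and $q\in\{3,\dots,n-2\}$. In local coordinates $x^1,\dots,x^n$ of an $n$-dimensional manifold, the formula $$\zeta=(dx^1\wedge dx^2+dx^3\wedge dx^4)\wedge(dx^5+x^1dx^2-x^3dx^4)\wedge dx^6\wedge\ldots\wedge dx^{q+2}$$ (where the factor $dx^6\wedge\ldots\wedge dx^{q+2}$ is absent if $q=3$) defines, on the coordinate domain, a differential $q$-form $\zeta$ which is algebraically constant and closed, but not integrable.
   Context: A tensor field $\Theta$ (in particular, a differential form) on a manifold $M$ is algebraically constant if for any $x,y\in M$ some linear isomorphism $T_xM\to T_yM$ sends $\Theta_x$ to $\Theta_y$; it is integrable if $\nabla\Theta=0$ for some torsion-free connection $\nabla$ on $M$. *)

theory Defs
  imports "HOL-Analysis.Analysis"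
begin

text \<open>
  A coordinate domain of an \<open>n\<close>-manifold is identified, through its coordinates, with an open set
  \<open>U\<close> of \<open>real ^ 'n\<close>, where \<open>CARD('n) = n\<close>; every tangent space is then \<open>real ^ 'n\<close>.
  Functions and fields are total functions of which only the values on \<open>U\<close> matter.
\<close>

type_synonym 'n vfield = "real ^ 'n \<Rightarrow> real ^ 'n"

text \<open>A \<open>k\<close>-tuple of tangent vectors is a function on \<open>nat\<close>, of which only the entries
  at \<open>0, \<dots>, k - 1\<close> matter.\<close>

type_synonym 'n tfield = "real ^ 'n \<Rightarrow> (nat \<Rightarrow> real ^ 'n) \<Rightarrow> real"

primrec times_diff_on ::
    "nat \<Rightarrow> (real ^ 'n) set \<Rightarrow> (real ^ 'n \<Rightarrow> 'b::real_normed_vector) \<Rightarrow> bool" where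
  "times_diff_on 0 U f \<longleftrightarrow> continuous_on U f"
| "times_diff_on (Suc k) U f \<longleftrightarrow> (\<forall>x\<in>U. f differentiable (at x)) \<and>
     (\<forall>v. times_diff_on k U (\<lambda>x. frechet_derivative f (at x) v))"

definition smooth_on :: "(real ^ 'n) set \<Rightarrow> (real ^ 'n \<Rightarrow> 'b::real_normed_vector) \<Rightarrow> bool" where
  "smooth_on U f \<longleftrightarrow> (\<forall>k. times_diff_on k U f)"

definition multilinear :: "nat \<Rightarrow> ((nat \<Rightarrow> real ^ 'n) \<Rightarrow> real) \<Rightarrow> bool" where
  "multilinear k \<alpha> \<longleftrightarrow>
     (\<forall>v w. (\<forall>i<k. v i = w i) \<longrightarrow> \<alpha> v = \<alpha> w) \<and>
     (\<forall>v. \<forall>i<k. linear (\<lambda>u. \<alpha> (v(i := u))))"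

definition alternating :: "nat \<Rightarrow> ((nat \<Rightarrow> real ^ 'n) \<Rightarrow> real) \<Rightarrow> bool" where
  "alternating k \<alpha> \<longleftrightarrow> (\<forall>v i j. i < j \<and> j < k \<and> v i = v j \<longrightarrow> \<alpha> v = 0)"

definition differential_form_on :: "(real ^ 'n) set \<Rightarrow> nat \<Rightarrow> 'n tfield \<Rightarrow> bool" where
  "differential_form_on U k \<omega> \<longleftrightarrow>
     (\<forall>x\<in>U. multilinear k (\<omega> x) \<and> alternating k (\<omega> x)) \<and>
     (\<forall>v. smooth_on U (\<lambda>x. \<omega> x v))"

text \<open>The wedge product of a \<open>k\<close>-form and an \<open>l\<close>-form, normalised so that
  \<open>(\<alpha> \<and> \<beta>)(u, v) = \<alpha> u * \<beta> v - \<alpha> v * \<beta> u\<close> for 1-forms.\<close>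

definition wedge :: "nat \<Rightarrow> nat \<Rightarrow> 'n tfield \<Rightarrow> 'n tfield \<Rightarrow> 'n tfield" where
  "wedge k l \<alpha> \<beta> = (\<lambda>x v.
     (\<Sum>\<sigma> | \<sigma> permutes {..<k + l}.
        of_int (sign \<sigma>) * \<alpha> x (\<lambda>i. v (\<sigma> i)) * \<beta> x (\<lambda>i. v (\<sigma> (k + i))))
     / (fact k * fact l))"

text \<open>The exterior derivative of a \<open>k\<close>-form, evaluated on constant vector fields (whose
  brackets vanish); the \<open>i\<close>-th vector is omitted from the argument of \<open>\<omega>\<close>.\<close>

definition ext_deriv :: "nat \<Rightarrow> ('n::finite) tfield \<Rightarrow> 'n tfield" where
  "ext_deriv k \<omega> = (\<lambda>x v.
     \<Sum>i\<le>k. (-1) ^ i *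
       frechet_derivative (\<lambda>y. \<omega> y (\<lambda>j. v (if j < i then j else Suc j))) (at x) (v i))"

definition closed_form_on :: "(real ^ 'n) set \<Rightarrow> nat \<Rightarrow> 'n tfield \<Rightarrow> bool" where
  "closed_form_on U k \<omega> \<longleftrightarrow> (\<forall>x\<in>U. \<forall>v. ext_deriv k \<omega> x v = 0)"

definition algebraically_constant_on :: "(real ^ 'n) set \<Rightarrow> 'n tfield \<Rightarrow> bool" where
  "algebraically_constant_on U \<Theta> \<longleftrightarrow>
     (\<forall>x\<in>U. \<forall>y\<in>U. \<exists>L :: real ^ 'n \<Rightarrow> real ^ 'n.
        linear L \<and> bij L \<and> (\<forall>v. \<Theta> y (\<lambda>i. L (v i)) = \<Theta> x v))"

definition vderiv :: "('n::finite) vfield \<Rightarrow> (real ^ 'n \<Rightarrow> 'b::real_normed_vector) \<Rightarrow> real ^ 'n \<Rightarrow> 'b" where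
  "vderiv X f = (\<lambda>x. frechet_derivative f (at x) (X x))"

definition lie_bracket :: "('n::finite) vfield \<Rightarrow> 'n vfield \<Rightarrow> 'n vfield" where
  "lie_bracket X Y = (\<lambda>x. vderiv X Y x - vderiv Y X x)"

text \<open>Linear connections on the tangent bundle of \<open>U\<close>, in the sense of Koszul. The two rules for
  multiplication by a function give homogeneity over the reals (\<open>f\<close> constant) and, for \<open>f\<close>
  vanishing exactly on \<open>U\<close>, independence of the values of the fields outside the open set \<open>U\<close>.\<close>

definition connection_on :: "(real ^ 'n) set \<Rightarrow> ('n vfield \<Rightarrow> 'n vfield \<Rightarrow> 'n vfield) \<Rightarrow> bool" where
  "connection_on U D \<longleftrightarrow>
     (\<forall>X Y. smooth_on U X \<and> smooth_on U Y \<longrightarrow> smooth_on U (D X Y)) \<and>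
     (\<forall>X X' Y. smooth_on U X \<and> smooth_on U X' \<and> smooth_on U Y \<longrightarrow>
        (\<forall>x\<in>U. D (\<lambda>y. X y + X' y) Y x = D X Y x + D X' Y x)) \<and>
     (\<forall>X Y Y'. smooth_on U X \<and> smooth_on U Y \<and> smooth_on U Y' \<longrightarrow>
        (\<forall>x\<in>U. D X (\<lambda>y. Y y + Y' y) x = D X Y x + D X Y' x)) \<and>
     (\<forall>f X Y. smooth_on U f \<and> smooth_on U X \<and> smooth_on U Y \<longrightarrow>
        (\<forall>x\<in>U. D (\<lambda>y. f y *\<^sub>R X y) Y x = f x *\<^sub>R D X Y x)) \<and>
     (\<forall>f X Y. smooth_on U f \<and> smooth_on U X \<and> smooth_on U Y \<longrightarrow>
        (\<forall>x\<in>U. D X (\<lambda>y. f y *\<^sub>R Y y) x = vderiv X f x *\<^sub>R Y x + f x *\<^sub>R D X Y x))"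

definition torsion_free_on ::
    "(real ^ 'n) set \<Rightarrow> ('n vfield \<Rightarrow> 'n vfield \<Rightarrow> 'n vfield) \<Rightarrow> bool" where
  "torsion_free_on U D \<longleftrightarrow>
     (\<forall>X Y. smooth_on U X \<and> smooth_on U Y \<longrightarrow>
        (\<forall>x\<in>U. D X Y x - D Y X x = lie_bracket X Y x))"

definition cov_deriv ::
    "(('n::finite) vfield \<Rightarrow> 'n vfield \<Rightarrow> 'n vfield) \<Rightarrow> nat \<Rightarrow> 'n tfield \<Rightarrow> 'n vfield \<Rightarrow> (nat \<Rightarrow> 'n vfield)
      \<Rightarrow> real ^ 'n \<Rightarrow> real" where
  "cov_deriv D k \<Theta> X Y = (\<lambda>x. vderiv X (\<lambda>y. \<Theta> y (\<lambda>j. Y j y)) x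
     - (\<Sum>i<k. \<Theta> x (\<lambda>j. if j = i then D X (Y i) x else Y j x)))"

definition parallel_on ::
    "(real ^ 'n) set \<Rightarrow> ('n vfield \<Rightarrow> 'n vfield \<Rightarrow> 'n vfield) \<Rightarrow> nat \<Rightarrow> 'n tfield \<Rightarrow> bool" where
  "parallel_on U D k \<Theta> \<longleftrightarrow>
     (\<forall>X Y. smooth_on U X \<and> (\<forall>i<k. smooth_on U (Y i)) \<longrightarrow>
        (\<forall>x\<in>U. cov_deriv D k \<Theta> X Y x = 0))"

definition integrable_tensor_on :: "(real ^ 'n) set \<Rightarrow> nat \<Rightarrow> 'n tfield \<Rightarrow> bool" where
  "integrable_tensor_on U k \<Theta> \<longleftrightarrow>
     (\<exists>D. connection_on U D \<and> torsion_free_on U D \<and> parallel_on U D k \<Theta>)"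

text \<open>In what follows \<open>c\<close> numbers the coordinates: the \<open>i\<close>-th coordinate function is
  \<open>\<lambda>x. x $ c i\<close>.\<close>

definition dx :: "(nat \<Rightarrow> 'n::finite) \<Rightarrow> nat \<Rightarrow> 'n tfield" where
  "dx c i = (\<lambda>x v. v 0 $ c i)"

text \<open>The product of the \<open>m\<close> factors \<open>dx c a\<close>, \<open>dx c (a + 1)\<close>, \<open>\<dots>\<close>; for \<open>m = 0\<close> it is the
  constant function 1, the unit of the wedge product.\<close>

primrec dx_wedge :: "(nat \<Rightarrow> 'n::finite) \<Rightarrow> nat \<Rightarrow> nat \<Rightarrow> 'n tfield" where
  "dx_wedge c a 0 = (\<lambda>x v. 1)"
| "dx_wedge c a (Suc m) = wedge m 1 (dx_wedge c a m) (dx c (a + m))"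

definition zeta :: "(nat \<Rightarrow> 'n::finite) \<Rightarrow> nat \<Rightarrow> 'n tfield" where
  "zeta c q =
     wedge 3 (q - 3)
       (wedge 2 1
         (\<lambda>x v. wedge 1 1 (dx c 1) (dx c 2) x v + wedge 1 1 (dx c 3) (dx c 4) x v)
         (\<lambda>x v. dx c 5 x v + x $ c 1 * dx c 2 x v - x $ c 3 * dx c 4 x v))
       (dx_wedge c 6 (q - 3))"

end

theory Submission imports Defs "Jordan_Normal_Form.Determinant" begin

text \<open>
  With \<open>\<theta> = dx\<^sup>5 + x\<^sup>1 dx\<^sup>2 - x\<^sup>3 dx\<^sup>4\<close>, the form \<open>zeta\<close> has constant coefficients in the coframe
  \<open>dx\<^sup>1, \<dots>, dx\<^sup>4, \<theta>, dx\<^sup>6, \<dots>\<close>, so it is algebraically constant. It is closed since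
  \<open>(dx\<^sup>1 \<and> dx\<^sup>2 + dx\<^sup>3 \<and> dx\<^sup>4) \<and> d\<theta> = 0\<close>. The common kernel of \<open>\<theta>, dx\<^sup>6, \<dots>, dx\<^bsup>q+2\<^esup>\<close> is determined by
  \<open>zeta\<close>, hence would be parallel for a connection \<open>D\<close> with \<open>D zeta = 0\<close>, and so involutive if \<open>D\<close> is
  torsion-free; but it contains \<open>E\<^sub>1 = e\<^sub>1\<close> and \<open>E\<^sub>2 = e\<^sub>2 - x\<^sup>1 e\<^sub>5\<close>, whose bracket is \<open>- e\<^sub>5\<close>.

  Wedge products of 1-forms are evaluated as determinants, which makes Laplace expansion available.
\<close>

no_notation vec_index (infixl \<open>$\<close> 100)

section \<open>Determinants of covectors and Laplace expansion\<close>

definition det_form ::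
    "nat \<Rightarrow> (nat \<Rightarrow> 'v \<Rightarrow> real) \<Rightarrow> (nat \<Rightarrow> 'v) \<Rightarrow> real" where
  "det_form k f v = Determinant.det (mat k k (\<lambda>(i, j). f i (v j)))"

lemma det_form_cong:
  assumes "\<And>i j. i < k \<Longrightarrow> j < k \<Longrightarrow> f i (v j) = g i (w j)"
  shows "det_form k f v = det_form k g w"
  unfolding det_form_def by (rule arg_cong[where f = Determinant.det]) (auto intro!: eq_matI assms)

lemma det_form_sum:
  "det_form k f v = (\<Sum>\<sigma> | \<sigma> permutes {..<k}. of_int (sign \<sigma>) * (\<Prod>i<k. f i (v (\<sigma> i))))"
proof -
  have "(\<Prod>i<k. mat k k (\<lambda>(i, j). f i (v j)) $$ (i, \<sigma> i)) = (\<Prod>i<k. f i (v (\<sigma> i)))"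
    if "\<sigma> permutes {..<k}" for \<sigma>
    by (rule prod.cong) (use permutes_in_image[OF that] in auto)
  then show ?thesis
    unfolding det_form_def by (subst det_def'[where n = k]) (auto simp: atLeast0LessThan intro!: sum.cong)
qed

lemma det_form_0 [simp]: "det_form 0 f v = 1"
  by (simp add: det_form_sum)

lemma det_form_1 [simp]: "det_form (Suc 0) f v = f 0 (v 0)"
  by (simp add: det_form_def det_single)

text \<open>The shape is that of the omission in \<open>ext_deriv\<close>, so that the arguments
  there fold to \<open>v (skip i j)\<close> and match the minors of a determinant.\<close>

definition skip :: "nat \<Rightarrow> nat \<Rightarrow> nat" where
  "skip i j = (if j < i then j else Suc j)"

lemma cofactor_mat:
  "cofactor (mat k k (\<lambda>(i, j). f i (v j))) r s =
     (- 1) ^ (r + s) * det_form (k - 1) (\<lambda>i. f (skip r i)) (\<lambda>j. v (skip s j))"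
  unfolding cofactor_def det_form_def mat_delete_def skip_def
  by (rule arg_cong2[where f = "(*)"], simp, rule arg_cong[where f = Determinant.det])
    (auto intro!: eq_matI)

lemma det_form_expand_row:
  assumes "r < k"
  shows "det_form k f v = (\<Sum>s<k. f r (v s) *
    ((- 1) ^ (r + s) * det_form (k - 1) (\<lambda>i. f (skip r i)) (\<lambda>j. v (skip s j))))"
  unfolding det_form_def[of k]
  by (subst laplace_expansion_row[where n = k, OF _ assms]) (use assms in \<open>auto simp: cofactor_mat\<close>)

lemma det_form_expand_column:
  assumes "s < k"
  shows "det_form k f v = (\<Sum>r<k. f r (v s) *
    ((- 1) ^ (r + s) * det_form (k - 1) (\<lambda>i. f (skip r i)) (\<lambda>j. v (skip s j))))"
  unfolding det_form_def[of k]
  by (subst laplace_expansion_column[where n = k, OF _ assms]) (use assms in \<open>auto simp: cofactor_mat\<close>)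

lemma skip_neq [simp]: "skip i j \<noteq> i"
  by (auto simp: skip_def)

lemma det_form_identical_args:
  assumes "i \<noteq> j" "i < k" "j < k" "v i = v j"
  shows "det_form k f v = 0"
  unfolding det_form_def
  by (rule det_identical_columns[OF _ assms(1-3)]) (use assms in \<open>auto intro!: eq_vecI\<close>)

lemma det_form_identical_rows:
  assumes "i \<noteq> j" "i < k" "j < k" "\<And>s. s < k \<Longrightarrow> f i (v s) = f j (v s)"
  shows "det_form k f v = 0"
  unfolding det_form_def
  by (rule det_identical_rows[OF _ assms(1-3)]) (use assms in \<open>auto intro!: eq_vecI\<close>)

lemma det_form_swap_rows:
  assumes "a \<noteq> b" "a < k" "b < k"
  shows "det_form k (\<lambda>i. f (Transposition.transpose a b i)) v = - det_form k f v"
proof -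
  let ?A = "mat k k (\<lambda>(i, j). f i (v j))"
  have "mat k k (\<lambda>(i, j). f (Transposition.transpose a b i) (v j)) = swaprows a b ?A"
    using assms by (auto intro!: eq_matI simp: Transposition.transpose_def)
  then show ?thesis
    unfolding det_form_def using det_swaprows[of a k b ?A] assms by simp
qed

lemma det_form_zero_row:
  assumes "r < k" "\<And>s. s < k \<Longrightarrow> f r (v s) = 0"
  shows "det_form k f v = 0"
  by (subst det_form_expand_row[OF assms(1)]) (simp add: assms(2))

text \<open>Two rows supported in the same single column are proportional. Expanding along row
  \<open>r\<close> leaves only the term of column \<open>m\<close>, and its minor contains what
  remains of row \<open>p\<close>, which is zero.\<close>

lemma det_form_parallel_rows:
  assumes "p \<noteq> r" "p < k" "r < k" "m < k"
    and p: "\<And>s. s < k \<Longrightarrow> s \<noteq> m \<Longrightarrow> f p (v s) = 0"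
    and r: "\<And>s. s < k \<Longrightarrow> s \<noteq> m \<Longrightarrow> f r (v s) = 0"
  shows "det_form k f v = 0"
proof -
  \<comment> \<open>The position of row \<open>p\<close> once row \<open>r\<close> has been
    deleted.\<close>
  define i where "i = (if p < r then p else p - 1)"
  have i: "i < k - 1" "skip r i = p"
    using assms(1-3) by (auto simp: i_def skip_def)
  have "f r (v s) * ((- 1) ^ (r + s) * det_form (k - 1) (\<lambda>i. f (skip r i)) (\<lambda>j. v (skip s j))) = 0"
    if s: "s < k" for s
  proof (cases "s = m")
    case True
    have "det_form (k - 1) (\<lambda>i. f (skip r i)) (\<lambda>j. v (skip s j)) = 0"
      by (rule det_form_zero_row[OF i(1)]) (use i(2) p True in \<open>auto simp: skip_def\<close>)
    then show ?thesis by simp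
  qed (simp add: r s)
  then show ?thesis
    by (subst det_form_expand_row[OF assms(3)]) (simp add: sum.neutral)
qed

lemma det_form_row_affine:
  assumes "r < k"
  shows "det_form k (f(r := \<lambda>u. a u + t * b u)) v =
    det_form k (f(r := a)) v + t * det_form k (f(r := b)) v"
proof -
  have *: "(\<lambda>i. (f(r := g)) (skip r i)) = (\<lambda>i. f (skip r i))" for g
    by auto
  show ?thesis
    unfolding det_form_expand_row[OF assms] *
    by (simp add: sum.distrib sum_distrib_left algebra_simps)
qed

lemma multilinear_det_form:
  assumes "\<And>i. linear (f i :: real ^ 'n \<Rightarrow> real)"
  shows "multilinear k (det_form k f)"
  unfolding multilinear_def
proof (intro conjI allI impI)
  fix v w :: "nat \<Rightarrow> real ^ 'n" assume "\<forall>i<k. v i = w i"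
  then show "det_form k f v = det_form k f w" by (auto intro: det_form_cong)
next
  fix v :: "nat \<Rightarrow> real ^ 'n" and i assume "i < k"
  have *: "(\<lambda>j. (v(i := u)) (skip i j)) = (\<lambda>j. v (skip i j))" for u
    by auto
  show "linear (\<lambda>u. det_form k f (v(i := u)))"
    unfolding det_form_expand_column[OF \<open>i < k\<close>] *
    by (rule linearI)
      (simp_all add: linear_add[OF assms] linear_scale[OF assms] sum.distrib sum_distrib_left algebra_simps)
qed

lemma alternating_det_form: "alternating k (det_form k f)"
  unfolding alternating_def
proof (intro allI impI, elim conjE)
  show "det_form k f v = 0" if "i < j" "j < k" "v i = v j" for v i j
    by (rule det_form_identical_args[of i j]) (use that in auto)
qed

lemma multilinear_add:
  fixes \<alpha> \<beta> :: "(nat \<Rightarrow> real ^ 'n) \<Rightarrow> real"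
  assumes "multilinear k \<alpha>" "multilinear k \<beta>"
  shows "multilinear k (\<lambda>v. \<alpha> v + \<beta> v)"
  unfolding multilinear_def
proof (intro conjI allI impI)
  fix v w :: "nat \<Rightarrow> real ^ 'n" assume "\<forall>i<k. v i = w i"
  then have "\<alpha> v = \<alpha> w" "\<beta> v = \<beta> w"
    using assms unfolding multilinear_def by blast+
  then show "\<alpha> v + \<beta> v = \<alpha> w + \<beta> w" by simp
next
  fix v :: "nat \<Rightarrow> real ^ 'n" and i assume "i < k"
  then show "linear (\<lambda>u. \<alpha> (v(i := u)) + \<beta> (v(i := u)))"
    using assms by (intro linear_compose_add) (simp_all add: multilinear_def)
qed

lemma alternating_add:
  assumes "alternating k \<alpha>" "alternating k \<beta>"
  shows "alternating k (\<lambda>v. \<alpha> v + \<beta> v)"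
  unfolding alternating_def
proof (intro allI impI)
  fix v :: "nat \<Rightarrow> real ^ 'a" and i j assume "i < j \<and> j < k \<and> v i = v j"
  then have "\<alpha> v = 0" "\<beta> v = 0"
    using assms unfolding alternating_def by blast+
  then show "\<alpha> v + \<beta> v = 0" by simp
qed

section \<open>Wedge products as determinants\<close>

lemma wedge_det_form:
  "wedge k l (\<lambda>x. det_form k (f x)) (\<lambda>x. det_form l (g x)) =
     (\<lambda>x. det_form (k + l) (\<lambda>i. if i < k then f x i else g x (i - k)))"
proof (intro ext)
  fix x v
  define S where "S m = {\<sigma>. \<sigma> permutes {..<m::nat}}" for m
  define F where "F i = (if i < k then f x i else g x (i - k))" for i
  define P where "P \<pi> = (of_int (sign \<pi>) * (\<Prod>i<k + l. F i (v (\<pi> i))) :: real)" for \<pi>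
  \<comment> \<open>\<open>B \<tau> \<rho>\<close> is the block permutation acting by \<open>\<tau>\<close> on the first \<open>k\<close> and by \<open>\<rho>\<close> on the last \<open>l\<close>
    indices; substituting \<open>\<sigma> \<circ> B \<tau> \<rho>\<close> for \<open>\<sigma>\<close> makes the \<open>k! l!\<close> inner sums equal.\<close>
  define B where "B \<tau> \<rho> = \<tau> \<circ> map_permutation {..<l} ((+) k) \<rho>" for \<tau> \<rho> :: "nat \<Rightarrow> nat"
  have bij: "bij_betw ((+) k) {..<l} {k..<k + l}"
    by (simp add: bij_betw_def atLeast0LessThan[symmetric] add.commute)
  have shift: "map_permutation {..<l} ((+) k) \<rho> permutes {k..<k + l}" if "\<rho> \<in> S l" for \<rho>
    using map_permutation_permutes[OF bij] that by (simp add: S_def)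
  have B: "B \<tau> \<rho> permutes {..<k + l}" "sign (B \<tau> \<rho>) = sign \<tau> * sign \<rho>"
    "\<And>i. i < k \<Longrightarrow> B \<tau> \<rho> i = \<tau> i" "\<And>j. j < l \<Longrightarrow> B \<tau> \<rho> (k + j) = k + \<rho> j"
    if \<tau>: "\<tau> \<in> S k" and \<rho>: "\<rho> \<in> S l" for \<tau> \<rho>
  proof -
    have 1: "\<tau> permutes {..<k + l}"
      by (rule permutes_subset[of _ "{..<k}"]) (use \<tau> in \<open>auto simp: S_def\<close>)
    have 2: "map_permutation {..<l} ((+) k) \<rho> permutes {..<k + l}"
      by (rule permutes_subset[OF shift[OF \<rho>]]) auto
    show "B \<tau> \<rho> permutes {..<k + l}"
      unfolding B_def by (rule permutes_compose[OF 2 1])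
    have "sign (map_permutation {..<l} ((+) k) \<rho>) = sign \<rho>"
      by (rule sign_map_permutation) (use \<rho> in \<open>auto simp: S_def\<close>)
    then show "sign (B \<tau> \<rho>) = sign \<tau> * sign \<rho>"
      unfolding B_def using 1 2 by (subst sign_compose) (auto intro: permutes_imp_permutation)
    show "B \<tau> \<rho> i = \<tau> i" if "i < k" for i
      using permutes_not_in[OF shift[OF \<rho>], of i] that by (simp add: B_def)
    show "B \<tau> \<rho> (k + j) = k + \<rho> j" if "j < l" for j
      using \<tau> that by (simp add: B_def map_permutation_apply S_def permutes_not_in[of \<tau> "{..<k}"])
  qed
  have P: "of_int (sign \<sigma>) * (of_int (sign \<tau>) * (\<Prod>i<k. f x i (v (\<sigma> (\<tau> i))))) *
      (of_int (sign \<rho>) * (\<Prod>j<l. g x j (v (\<sigma> (k + \<rho> j))))) = P (\<sigma> \<circ> B \<tau> \<rho>)"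
    if \<sigma>: "\<sigma> \<in> S (k + l)" and \<tau>: "\<tau> \<in> S k" and \<rho>: "\<rho> \<in> S l" for \<sigma> \<tau> \<rho>
  proof -
    have "(\<Prod>i<k + l. F i (v (\<sigma> (B \<tau> \<rho> i)))) =
        (\<Prod>i<k. F i (v (\<sigma> (B \<tau> \<rho> i)))) * (\<Prod>j<l. F (k + j) (v (\<sigma> (B \<tau> \<rho> (k + j)))))"
      by (induction l) (simp_all add: mult.assoc)
    also have "\<dots> = (\<Prod>i<k. f x i (v (\<sigma> (\<tau> i)))) * (\<Prod>j<l. g x j (v (\<sigma> (k + \<rho> j))))"
      by (intro arg_cong2[where f = "(*)"] prod.cong) (simp_all add: F_def B[OF \<tau> \<rho>])
    finally have 1: "(\<Prod>i<k + l. F i (v (\<sigma> (B \<tau> \<rho> i)))) = \<dots>" .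
    have 2: "sign (\<sigma> \<circ> B \<tau> \<rho>) = sign \<sigma> * (sign \<tau> * sign \<rho>)"
      using B(1,2)[OF \<tau> \<rho>] \<sigma>
      by (subst sign_compose) (auto simp: S_def intro: permutes_imp_permutation[of "{..<k + l}"])
    show ?thesis
      unfolding P_def 2 o_apply 1 by simp
  qed
  have "(\<Sum>\<sigma>\<in>S (k + l). of_int (sign \<sigma>) * det_form k (f x) (\<lambda>i. v (\<sigma> i)) *
      det_form l (g x) (\<lambda>i. v (\<sigma> (k + i)))) =
      (\<Sum>\<sigma>\<in>S (k + l). \<Sum>\<tau>\<in>S k. \<Sum>\<rho>\<in>S l. P (\<sigma> \<circ> B \<tau> \<rho>))"
    unfolding det_form_sum S_def[symmetric] sum_distrib_left sum_distrib_right
    by (subst sum.swap[of _ "S l"]) (intro sum.cong refl P)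
  also have "\<dots> = (\<Sum>\<tau>\<in>S k. \<Sum>\<rho>\<in>S l. \<Sum>\<sigma>\<in>S (k + l). P (\<sigma> \<circ> B \<tau> \<rho>))"
    by (subst sum.swap, rule sum.cong[OF refl], rule sum.swap)
  also have "\<dots> = (\<Sum>\<tau>\<in>S k. \<Sum>\<rho>\<in>S l. \<Sum>\<sigma>\<in>S (k + l). P \<sigma>)"
    unfolding S_def[of "k + l"]
    by (intro sum.cong refl sum_permutations_compose_right[symmetric] B(1))
  also have "\<dots> = fact k * fact l * det_form (k + l) F v"
    using card_permutations[of "{..<k}" k] card_permutations[of "{..<l}" l]
    by (simp add: det_form_sum P_def S_def)
  finally show "wedge k l (\<lambda>x. det_form k (f x)) (\<lambda>x. det_form l (g x)) x v =
      det_form (k + l) (\<lambda>i. if i < k then f x i else g x (i - k)) v"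
    unfolding wedge_def S_def[symmetric] F_def[symmetric] by simp
qed


lemma wedge_add_left:
  "wedge k l (\<lambda>x v. \<alpha> x v + \<beta> x v) \<gamma> = (\<lambda>x v. wedge k l \<alpha> \<gamma> x v + wedge k l \<beta> \<gamma> x v)"
  by (simp add: wedge_def sum.distrib add_divide_distrib ring_distribs)

section \<open>\<open>zeta\<close> as a sum of two determinants\<close>

definition contact_form :: "(nat \<Rightarrow> 'n::finite) \<Rightarrow> real ^ 'n \<Rightarrow> real ^ 'n \<Rightarrow> real" where
  "contact_form c x u = u $ c 5 + x $ c 1 * u $ c 2 - x $ c 3 * u $ c 4"

text \<open>Row 2 is left open: it holds \<open>contact_form c x\<close> in \<open>zeta\<close>
  itself and a single coordinate covector once that row has been expanded. From row 3 on, the shift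
  by 3 makes the coordinates start at 6.\<close>

definition factors :: "(nat \<Rightarrow> 'n::finite) \<Rightarrow> nat \<Rightarrow> nat \<Rightarrow> (real ^ 'n \<Rightarrow> real) \<Rightarrow>
    nat \<Rightarrow> real ^ 'n \<Rightarrow> real" where
  "factors c a b t i = (if i = 0 then (\<lambda>u. u $ c a) else if i = 1 then (\<lambda>u. u $ c b)
     else if i = 2 then t else (\<lambda>u. u $ c (i + 3)))"

lemma factors_simps [simp]:
  "factors c a b t 0 = (\<lambda>u. u $ c a)"
  "factors c a b t (Suc 0) = (\<lambda>u. u $ c b)"
  "factors c a b t 2 = t"
  "3 \<le> i \<Longrightarrow> factors c a b t i = (\<lambda>u. u $ c (i + 3))"
  by (simp_all add: factors_def)

lemma dx_eq_det_form: "dx c i = (\<lambda>x. det_form 1 (\<lambda>_ u. u $ c i))"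
  by (simp add: dx_def fun_eq_iff)

lemma dx_wedge_eq_det_form: "dx_wedge c a m = (\<lambda>x. det_form m (\<lambda>i u. u $ c (a + i)))"
proof (induction m)
  case (Suc m)
  show ?case
    unfolding dx_wedge.simps Suc dx_eq_det_form wedge_det_form
    by (intro ext) (auto intro!: det_form_cong simp: less_Suc_eq)
qed simp

lemma wedge_factors:
  assumes "3 \<le> q"
  shows "wedge 3 (q - 3) (wedge 2 1 (wedge 1 1 (dx c a) (dx c b)) (\<lambda>x v. t x (v 0))) (dx_wedge c 6 (q - 3))
    = (\<lambda>x. det_form q (factors c a b (t x)))"
proof -
  have t: "(\<lambda>x v. t x (v 0)) = (\<lambda>x. det_form 1 (\<lambda>_. t x))"
    by (simp add: fun_eq_iff)
  have 2: "wedge 1 1 (dx c a) (dx c b) = (\<lambda>x. det_form 2 (factors c a b (t x)))"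
    unfolding dx_eq_det_form wedge_det_form one_add_one
    by (intro ext) (auto intro!: det_form_cong simp: less_Suc_eq numeral_2_eq_2)
  have 3: "wedge 2 1 (wedge 1 1 (dx c a) (dx c b)) (\<lambda>x v. t x (v 0)) =
      (\<lambda>x. det_form (2 + 1) (factors c a b (t x)))"
    unfolding 2 t wedge_det_form
    by (intro ext) (auto intro!: det_form_cong simp: factors_def)
  have "(2 + 1 :: nat) = 3" "3 + (q - 3) = q"
    using assms by simp_all
  then show ?thesis
    unfolding 3 dx_wedge_eq_det_form
    by (simp only: wedge_det_form)
      (intro ext, auto intro!: det_form_cong simp: add.commute[of 3])
qed

lemma zeta_eq_det_form:
  assumes "3 \<le> q"
  shows "zeta c q = (\<lambda>x v. det_form q (factors c 1 2 (contact_form c x)) v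
    + det_form q (factors c 3 4 (contact_form c x)) v)"
proof -
  have "(\<lambda>x v. dx c 5 x v + x $ c 1 * dx c 2 x v - x $ c 3 * dx c 4 x v) =
      (\<lambda>x v. contact_form c x (v 0))"
    by (simp add: dx_def contact_form_def)
  then show ?thesis
    unfolding zeta_def by (simp only: wedge_add_left wedge_factors[OF assms])
qed

lemma linear_factors:
  assumes "linear t"
  shows "linear (factors c a b t i)"
  unfolding factors_def using assms by (auto intro!: linearI simp: algebra_simps)

lemma linear_contact_form: "linear (contact_form c x)"
  by (rule linearI) (simp_all add: contact_form_def algebra_simps)

lemma zeta_multilinear:
  assumes "3 \<le> q"
  shows "multilinear q (zeta c q x)"
  unfolding zeta_eq_det_form[OF assms]
  by (intro multilinear_add multilinear_det_form linear_factors linear_contact_form)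

lemma zeta_alternating:
  assumes "3 \<le> q"
  shows "alternating q (zeta c q x)"
  unfolding zeta_eq_det_form[OF assms] by (intro alternating_add alternating_det_form)

abbreviation factors_dx :: "(nat \<Rightarrow> 'n::finite) \<Rightarrow> nat \<Rightarrow> nat \<Rightarrow> nat \<Rightarrow> nat \<Rightarrow> real ^ 'n \<Rightarrow> real" where
  "factors_dx c a b d \<equiv> factors c a b (\<lambda>u. u $ c d)"

text \<open>The point enters only through the \<open>contact_form\<close> row, in which the
  determinant is linear; the terms that repeat the row of coordinate 2 or 4 drop out. For fixed
  \<open>v\<close> the value is thus affine in \<open>x\<close>, which yields both smoothness and
  the exterior derivative.\<close>

lemma zeta_affine:
  assumes "3 \<le> q"
  shows "zeta c q x v = det_form q (factors_dx c 1 2 5) v + det_form q (factors_dx c 3 4 5) v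
    + (x $ c 1 * det_form q (factors_dx c 3 4 2) v - x $ c 3 * det_form q (factors_dx c 1 2 4) v)"
proof -
  have two: "2 < q"
    using assms by simp
  have upd: "factors c a b t = (factors_dx c a b 5)(2 := t)" for a b t
    by (auto simp: factors_def fun_eq_iff)
  have theta: "contact_form c x = (\<lambda>u. (u $ c 5 + x $ c 1 * u $ c 2) + (- x $ c 3) * u $ c 4)"
    by (simp add: contact_form_def fun_eq_iff)
  have expand: "det_form q (factors c a b (contact_form c x)) v = det_form q (factors_dx c a b 5) v
      + x $ c 1 * det_form q (factors_dx c a b 2) v - x $ c 3 * det_form q (factors_dx c a b 4) v" for a b
    unfolding upd[of a b "contact_form c x"] upd[of a b "\<lambda>u. u $ c 2"] upd[of a b "\<lambda>u. u $ c 4"]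
    unfolding theta det_form_row_affine[OF two] by (simp add: fun_upd_idem)
  have "det_form q (factors_dx c 1 2 2) v = 0"
    by (rule det_form_identical_rows[of 1 2]) (use assms in auto)
  moreover have "det_form q (factors_dx c 3 4 4) v = 0"
    by (rule det_form_identical_rows[of 1 2]) (use assms in auto)
  ultimately show ?thesis
    using expand[of 1 2] expand[of 3 4]
    unfolding zeta_eq_det_form[OF assms] by (simp add: algebra_simps)
qed

section \<open>Smoothness and closedness\<close>

lemma frechet_derivative_affine:
  assumes "bounded_linear g"
  shows "frechet_derivative (\<lambda>x. a + g x) (at x) = g"
proof -
  have "((\<lambda>x. a + g x) has_derivative g) (at x)"
    using has_derivative_add[OF has_derivative_const bounded_linear_imp_has_derivative[OF assms]] by simp
  then show ?thesis by (rule frechet_derivative_at[symmetric])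
qed

lemma smooth_on_affine:
  assumes "bounded_linear g"
  shows "smooth_on U (\<lambda>x. a + g x)"
proof -
  have "times_diff_on k U (\<lambda>x. a + g x)" for k
    using assms
  proof (induction k arbitrary: a g)
    \<comment> \<open>The directional derivative of an affine map is constant, hence again affine
      with zero linear part; this is why \<open>a\<close> and \<open>g\<close> are
      generalised.\<close>
    case 0
    then show ?case
      by (simp add: continuous_on_add linear_continuous_on)
  next
    case (Suc k)
    have "times_diff_on k U (\<lambda>x. g v)" for v
      using Suc.IH[of "\<lambda>_. 0" "g v"] by simp
    then show ?case
      using Suc.prems by (simp add: frechet_derivative_affine bounded_linear_imp_differentiable)
  qed
  then show ?thesis by (simp add: smooth_on_def)
qed

lemma smooth_on_const: "smooth_on U (\<lambda>x. a)"
  using smooth_on_affine[of "\<lambda>_. 0" U a] by simp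

lemma bounded_linear_zeta_variation: "bounded_linear (\<lambda>x. x $ i * s - x $ j * t :: real)"
  by (intro bounded_linear_sub bounded_linear_mult_const bounded_linear_vec_nth)

lemma zeta_differential_form:
  assumes "3 \<le> q"
  shows "differential_form_on U q (zeta c q)"
  unfolding differential_form_on_def
  by (simp add: zeta_multilinear zeta_alternating assms)
    (simp add: zeta_affine[OF assms] smooth_on_affine bounded_linear_zeta_variation)

lemma zeta_closed:
  assumes "3 \<le> q"
  shows "closed_form_on U q (zeta c q)"
  unfolding closed_form_on_def
proof (intro ballI allI)
  fix x v
  \<comment> \<open>\<open>G a f\<close> puts \<open>dx c a\<close> in front of the rows
    \<open>f\<close>. Laplace expansion along that new row 0 has the same alternating sum as
    \<open>ext_deriv\<close>.\<close>
  define G where "G a f = (\<lambda>i. case i of 0 \<Rightarrow> (\<lambda>u. u $ c a) | Suc i \<Rightarrow> f i)" for a and f :: "nat \<Rightarrow> real ^ 'a \<Rightarrow> real"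
  have expand: "det_form (Suc q) (G a f) v =
      (\<Sum>i\<le>q. (- 1) ^ i * (v i $ c a * det_form q f (\<lambda>j. v (skip i j))))" for a f
    by (subst det_form_expand_row[of 0])
      (auto simp: G_def skip_def lessThan_Suc_atMost intro!: sum.cong)
  have "ext_deriv q (zeta c q) x v =
      (\<Sum>i\<le>q. (- 1) ^ i * (v i $ c 1 * det_form q (factors_dx c 3 4 2) (\<lambda>j. v (skip i j))
        - v i $ c 3 * det_form q (factors_dx c 1 2 4) (\<lambda>j. v (skip i j))))"
    unfolding ext_deriv_def skip_def[symmetric]
    by (simp add: zeta_affine[OF assms] frechet_derivative_affine bounded_linear_zeta_variation)
  also have "\<dots> = det_form (Suc q) (G 1 (factors_dx c 3 4 2)) v - det_form (Suc q) (G 3 (factors_dx c 1 2 4)) v"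
    unfolding expand by (simp add: right_diff_distrib sum_subtractf)
  \<comment> \<open>\<open>dx\<^sup>1 \<and> dx\<^sup>3 \<and> dx\<^sup>4 \<and> dx\<^sup>2\<close> and \<open>dx\<^sup>3 \<and> dx\<^sup>1 \<and> dx\<^sup>2 \<and> dx\<^sup>4\<close> differ by two transpositions\<close>
  also have "G 1 (factors_dx c 3 4 2) = (\<lambda>i. G 3 (factors_dx c 1 2 4)
      (Transposition.transpose 0 1 (Transposition.transpose 2 3 i)))"
  proof
    fix i :: nat
    have "i = 0 \<or> i = 1 \<or> i = 2 \<or> i = 3 \<or> (\<exists>j. i = Suc j \<and> 3 \<le> j)"
      by presburger
    then show "G 1 (factors_dx c 3 4 2) i = G 3 (factors_dx c 1 2 4)
        (Transposition.transpose 0 1 (Transposition.transpose 2 3 i))"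
      by (elim disjE exE conjE) (simp_all add: G_def Transposition.transpose_def numeral_3_eq_3 numeral_2_eq_2 factors_def)
  qed
  also have "det_form (Suc q) \<dots> v = det_form (Suc q) (G 3 (factors_dx c 1 2 4)) v"
    using det_form_swap_rows[of 2 3 "Suc q" "\<lambda>i. G 3 (factors_dx c 1 2 4) (Transposition.transpose 0 1 i)" v]
      det_form_swap_rows[of 0 1 "Suc q" "G 3 (factors_dx c 1 2 4)" v] assms by simp
  finally show "ext_deriv q (zeta c q) x v = 0" by simp
qed

section \<open>Algebraic constancy\<close>

context
  fixes c :: "nat \<Rightarrow> 'n::finite" and q :: nat
  assumes inj: "inj_on c {1..q + 2}" and q3: "3 \<le> q"
begin

lemma coord_eq_iff: "1 \<le> i \<Longrightarrow> i \<le> q + 2 \<Longrightarrow> 1 \<le> j \<Longrightarrow> j \<le> q + 2 \<Longrightarrow> c i = c j \<longleftrightarrow> i = j"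
  using inj_on_eq_iff[OF inj, of i j] by simp

lemma axis_coord: "1 \<le> i \<Longrightarrow> i \<le> q + 2 \<Longrightarrow> 1 \<le> j \<Longrightarrow> j \<le> q + 2 \<Longrightarrow>
    (axis (c i) 1 :: real ^ 'n) $ c j = (if i = j then 1 else 0)"
  using coord_eq_iff[of i j] by (auto simp: axis_def)

text \<open>The linear map that matches the coframe \<open>dx\<^sup>1, \<dots>, dx\<^sup>4, contact_form, dx\<^sup>6, \<dots>\<close> at \<open>y\<close> with
  the one at \<open>x\<close>.\<close>

lemma zeta_algebraically_constant: "algebraically_constant_on U (zeta c q)"
  unfolding algebraically_constant_on_def
proof (intro ballI)
  fix x y :: "real ^ 'n"
  \<comment> \<open>\<open>s x y\<close> is \<open>contact_form c x - contact_form c y\<close>.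
    Every contact form takes the value 1 on \<open>axis (c 5) 1\<close>, so adding this multiple of
    it corrects the difference exactly.\<close>
  define s where "s x y = (\<lambda>u. (x $ c 1 - y $ c 1) * u $ c 2 - (x $ c 3 - y $ c 3) * u $ c 4)"
    for x y u :: "real ^ 'n"
  define L where "L x y = (\<lambda>u. u + s x y u *\<^sub>R axis (c 5) 1)" for x y u :: "real ^ 'n"
  have coord: "L x y u $ c j = u $ c j" if "1 \<le> j" "j \<le> q + 2" "j \<noteq> 5" for x y u j
    using that q3 by (simp add: L_def axis_coord)
  have "linear (L x y)"
    by (rule linearI) (simp_all add: L_def s_def algebra_simps)
  \<comment> \<open>\<open>s\<close> reads only coordinates 2 and 4, which \<open>L\<close> fixes,
    and changes sign when \<open>x\<close> and \<open>y\<close> are exchanged.\<close>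
  moreover have "L y x (L x y u) = u" for x y u
  proof -
    have "s y x (L x y u) = - s x y u"
      unfolding s_def[of y x] using q3 by (simp add: coord) (simp add: s_def algebra_simps)
    then show ?thesis by (simp add: L_def[of y x]) (simp add: L_def)
  qed
  then have "bij (L x y)"
    by (intro bijI'[of "L x y"]) metis+
  moreover have "contact_form c y (L x y u) = contact_form c x u" for u
    using q3 unfolding contact_form_def by (simp add: coord) (simp add: L_def s_def algebra_simps axis_coord)
  then have factors: "factors c a b (contact_form c y) i (L x y u) = factors c a b (contact_form c x) i u"
    if "i < q" "(a, b) = (1, 2) \<or> (a, b) = (3, 4)" for a b i u
    using that q3 by (auto simp: factors_def coord)
  have "zeta c q y (\<lambda>i. L x y (v i)) = zeta c q x v" for v
    unfolding zeta_eq_det_form[OF q3] by (intro arg_cong2[where f = "(+)"] det_form_cong factors) simp_all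
  ultimately show "\<exists>L. linear L \<and> bij L \<and> (\<forall>v. zeta c q y (\<lambda>i. L (v i)) = zeta c q x v)"
    by blast
qed

section \<open>Non-integrability\<close>

definition horizontal4 :: "'n vfield" where
  "horizontal4 x = axis (c 4) 1 + (x $ c 3) *\<^sub>R axis (c 5) 1"

text \<open>All entries after the first lie in the kernel of \<open>contact_form c x\<close>; for
  \<open>horizontal4\<close> this is the purpose of its component along \<open>axis (c 5) 1\<close>.
  They are dual to the rows of coordinates 3, 4, 6, 7, and so on, so the first entry alone is tested
  by the contact form.\<close>

definition frame :: "real ^ 'n \<Rightarrow> real ^ 'n \<Rightarrow> nat \<Rightarrow> real ^ 'n" where
  "frame x a j = (if j = 0 then a else if j = 1 then axis (c 3) 1
     else if j = 2 then horizontal4 x else axis (c (j + 3)) 1)"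

lemma contact_form_frame: "0 < j \<Longrightarrow> j < q \<Longrightarrow> contact_form c x (frame x a j) = 0"
  using q3 by (auto simp: contact_form_def frame_def horizontal4_def axis_coord)

lemma frame_coord:
  assumes "j < q" "1 \<le> i" "i \<le> q + 2" "i \<noteq> 5"
  shows "frame x a j $ c i =
    (if j = 0 then a $ c i else if j = 1 then of_bool (i = 3) else if j = 2 then of_bool (i = 4)
     else of_bool (i = j + 3))"
  using assms q3 by (auto simp: frame_def horizontal4_def axis_coord)

text \<open>In the first summand the rows of coordinate 1 and of the contact form are both supported
  in column 0. In the second, the contact row has only its entry in column 0, with sign
  \<open>(- 1) ^ (2 + 0)\<close>, and the complementary minor is that of the identity
  matrix.\<close>

lemma zeta_frame_update_0: "zeta c q x ((frame x a)(0 := w)) = contact_form c x w"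
proof -
  let ?v = "(frame x a)(0 := w)" and ?f = "\<lambda>a b. factors c a b (contact_form c x)"
  have "det_form q (?f 1 2) ?v = 0"
    by (rule det_form_parallel_rows[of 0 2 _ 0])
      (use q3 in \<open>auto simp: contact_form_frame frame_coord\<close>)
  moreover have "det_form (q - 1) (\<lambda>i. ?f 3 4 (skip 2 i)) (\<lambda>j. ?v (skip 0 j)) = 1"
  proof -
    have "mat (q - 1) (q - 1) (\<lambda>(i, j). ?f 3 4 (skip 2 i) (?v (skip 0 j))) = 1\<^sub>m (q - 1)"
    proof (rule eq_matI)
      fix i j assume "i < dim_row (1\<^sub>m (q - 1))" "j < dim_col (1\<^sub>m (q - 1))"
      then have ij: "i < q - 1" "j < q - 1" by simp_all
      consider "i = 0" | "i = 1" | "i \<ge> 2" by linarith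
      then have "?f 3 4 (skip 2 i) (?v (skip 0 j)) = (if i = j then 1 else 0)"
        by cases (use ij in \<open>auto simp: skip_def frame_coord\<close>)
      then show "mat (q - 1) (q - 1) (\<lambda>(i, j). ?f 3 4 (skip 2 i) (?v (skip 0 j))) $$ (i, j) = 1\<^sub>m (q - 1) $$ (i, j)"
        using ij by simp
    qed simp_all
    then show ?thesis by (simp add: det_form_def)
  qed
  then have "det_form q (?f 3 4) ?v = contact_form c x w"
    using q3
    by (subst det_form_expand_row[of 2])
      (auto simp: contact_form_frame sum.remove[of "{..<q}" 0] intro!: sum.neutral)
  ultimately show ?thesis
    by (simp add: zeta_eq_det_form[OF q3])
qed

text \<open>The contact form kills every argument except \<open>w\<close>, so its row is supported
  in column \<open>m\<close>. In each summand a second row is too: either one that vanishes on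
  \<open>a\<close> and the whole frame, or the one dual to the replaced frame vector.\<close>

lemma zeta_frame_update:
  assumes "0 < m" "m < q" "contact_form c x a = 0" "r \<in> {1, 2}" "a $ c r = 0"
    "a $ c 3 = 0" "a $ c 4 = 0" "\<And>i. 6 \<le> i \<Longrightarrow> i \<le> q + 2 \<Longrightarrow> a $ c i = 0"
  shows "zeta c q x ((frame x a)(m := w)) = 0"
proof -
  let ?v = "(frame x a)(m := w)" and ?f = "\<lambda>a b. factors c a b (contact_form c x)"
  have theta: "contact_form c x (?v s) = 0" if "s < q" "s \<noteq> m" for s
    using that assms(3) contact_form_frame[of s] by (cases "s = 0") (auto simp: frame_def)
  have "det_form q (?f 1 2) ?v = 0"
  proof (cases "m < 3")
    case True
    then show ?thesis
      by (intro det_form_parallel_rows[of "r - 1" 2 _ m])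
        (use assms q3 theta in \<open>auto simp: frame_coord\<close>)
  next
    case False
    then show ?thesis
      by (intro det_form_parallel_rows[of m 2 _ m])
        (use assms q3 theta in \<open>auto simp: frame_coord\<close>)
  qed
  moreover have "det_form q (?f 3 4) ?v = 0"
    \<comment> \<open>Frame vectors 1 and 2 are dual to rows 0 and 1, the later ones to the row of
      their own index.\<close>
    by (rule det_form_parallel_rows[of "if m < 3 then m - 1 else m" 2 _ m])
      (use assms q3 theta in \<open>auto simp: frame_coord less_Suc_eq numeral_3_eq_3\<close>)
  ultimately show ?thesis
    by (simp add: zeta_eq_det_form[OF q3])
qed

lemma smooth_on_frame:
  assumes "smooth_on U A" "j < q"
  shows "smooth_on U (\<lambda>y. frame y (A y) j)"
proof -
  have "smooth_on U horizontal4"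
    unfolding horizontal4_def
    by (intro smooth_on_affine bounded_linear_scaleR_const bounded_linear_vec_nth)
  then show ?thesis
    using assms by (cases "j = 0"; cases "j = 1"; cases "j = 2") (simp_all add: frame_def smooth_on_const)
qed

text \<open>Evaluate \<open>D\<^sub>X zeta = 0\<close> on the frame that begins with \<open>A\<close>: only the term that differentiates
  \<open>A\<close> itself survives.\<close>

lemma contact_form_derivative:
  assumes parallel: "parallel_on U D q (zeta c q)" and x: "x \<in> U"
    and smooth: "smooth_on U X" "smooth_on U A"
    and theta: "\<And>y. contact_form c y (A y) = 0"
    and r: "r \<in> {1, 2}" and coords: "\<And>y. A y $ c r = 0" "\<And>y. A y $ c 3 = 0" "\<And>y. A y $ c 4 = 0"
      "\<And>y i. 6 \<le> i \<Longrightarrow> i \<le> q + 2 \<Longrightarrow> A y $ c i = 0"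
  shows "contact_form c x (D X A x) = 0"
proof -
  define Y where "Y j y = frame y (A y) j" for j y
  have Y0: "Y 0 = A"
    by (simp add: Y_def frame_def fun_eq_iff)
  have "(frame y (A y))(0 := A y) = frame y (A y)" for y
    by (rule fun_upd_idem) (simp add: frame_def)
  \<comment> \<open>\<open>zeta\<close> vanishes identically along the frame because
    \<open>A\<close> lies in the kernel of the contact form, so the derivative term of
    \<open>cov_deriv\<close> is zero.\<close>
  then have "zeta c q y (\<lambda>j. Y j y) = 0" for y
    using zeta_frame_update_0[of y "A y" "A y"] theta[of y] by (simp add: Y_def)
  then have "vderiv X (\<lambda>y. zeta c q y (\<lambda>j. Y j y)) x = 0"
    by (simp add: vderiv_def)
  moreover have "\<forall>i<q. smooth_on U (Y i)"
    unfolding Y_def by (simp add: smooth_on_frame smooth(2))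
  then have "cov_deriv D q (zeta c q) X Y x = 0"
    using parallel[unfolded parallel_on_def, rule_format, OF _ x] smooth(1) by simp
  moreover have "(\<lambda>j. if j = i then w else Y j x) = (frame x (A x))(i := w)" for i w
    by (simp add: fun_eq_iff Y_def)
  ultimately have "(\<Sum>i<q. zeta c q x ((frame x (A x))(i := D X (Y i) x))) = 0"
    unfolding cov_deriv_def by simp
  moreover have "zeta c q x ((frame x (A x))(i := D X (Y i) x)) = 0" if "i < q" "i \<noteq> 0" for i
    by (rule zeta_frame_update[where r = r]) (use that theta r coords in auto)
  ultimately show ?thesis
    using q3 by (simp add: sum.remove[of "{..<q}" 0] zeta_frame_update_0 Y0)
qed

lemma zeta_not_integrable:
  assumes "U \<noteq> {}"
  shows "\<not> integrable_tensor_on U q (zeta c q)"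
proof
  assume "integrable_tensor_on U q (zeta c q)"
  then obtain D where torsion: "torsion_free_on U D" and parallel: "parallel_on U D q (zeta c q)"
    unfolding integrable_tensor_on_def by blast
  obtain x where x: "x \<in> U" using assms by blast
  define E1 :: "'n vfield" where "E1 = (\<lambda>y. axis (c 1) 1)"
  \<comment> \<open>Written as a constant plus a linear map, the shape required by
    \<open>smooth_on_affine\<close> and \<open>frechet_derivative_affine\<close>.\<close>
  define E2 :: "'n vfield" where "E2 = (\<lambda>y. axis (c 2) 1 + - ((y $ c 1) *\<^sub>R axis (c 5) 1))"
  have bl: "bounded_linear (\<lambda>y::real ^ 'n. - ((y $ c 1) *\<^sub>R (axis (c 5) 1 :: real ^ 'n)))"
    by (intro bounded_linear_minus bounded_linear_scaleR_const bounded_linear_vec_nth)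
  have smooth: "smooth_on U E1" "smooth_on U E2"
    unfolding E1_def E2_def by (rule smooth_on_const, rule smooth_on_affine[OF bl])
  \<comment> \<open>\<open>r\<close> names a coordinate among the first two that vanishes on the
    differentiated field: 2 for \<open>E1\<close>, 1 for \<open>E2\<close>.\<close>
  have "contact_form c x (D E2 E1 x) = 0"
    by (rule contact_form_derivative[OF parallel x smooth(2,1), where r = 2])
      (use q3 in \<open>simp_all add: E1_def contact_form_def axis_coord\<close>)
  moreover have "contact_form c x (D E1 E2 x) = 0"
    by (rule contact_form_derivative[OF parallel x smooth, where r = 1])
      (use q3 in \<open>simp_all add: E2_def contact_form_def axis_coord\<close>)
  ultimately have "contact_form c x (D E1 E2 x - D E2 E1 x) = 0"
    by (simp add: linear_diff[OF linear_contact_form])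
  moreover have "D E1 E2 x - D E2 E1 x = lie_bracket E1 E2 x"
    using torsion smooth x unfolding torsion_free_on_def by blast
  moreover have "lie_bracket E1 E2 x = - axis (c 5) 1"
    unfolding lie_bracket_def vderiv_def E2_def frechet_derivative_affine[OF bl]
    using q3 by (simp add: E1_def axis_coord)
  ultimately show False
    using q3 by (simp add: contact_form_def axis_coord)
qed

end

theorem mainTheorem8:
  fixes U :: "(real ^ 'n) set" and c :: "nat \<Rightarrow> 'n" and n q :: nat
  assumes dim: "CARD('n) = n" and n: "n \<ge> 5" and q: "q \<in> {3..n - 2}"
    and coords: "bij_betw c {1..n} UNIV"
    and U: "open U" "U \<noteq> {}"
  shows "differential_form_on U q (zeta c q) \<and>
         algebraically_constant_on U (zeta c q) \<and>
         closed_form_on U q (zeta c q) \<and>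
         \<not> integrable_tensor_on U q (zeta c q)"
proof -
  have q3: "3 \<le> q"
    using q by simp
  have inj: "inj_on c {1..q + 2}"
    by (rule inj_on_subset[OF bij_betw_imp_inj_on[OF coords]]) (use n q in auto)
  show ?thesis
    using zeta_differential_form[OF q3] zeta_closed[OF q3] zeta_algebraically_constant[OF inj q3]
      zeta_not_integrable[OF inj q3 U(2)] by blast
qed

end
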